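(* Let $T$ be a $2$-homogeneous tree rooted at $o$ and let $1\le p<\infty$. Then for every self map $\phi:T\to T$, the composition operator $C_\phi$ is bounded on $\mathbb{T}_p$ and $\|C_\phi\|^p\le 2$.
   Context: $\mathbb{N}=\{1,2,\ldots\}$, $\mathbb{N}_0=\mathbb{N}\cup\{0\}$. A $2$-homogeneous tree is an (infinite) connected graph without cycles in which every vertex has exactly $2$ neighbours; it is rooted at a fixed vertex $o$. We identify $T$ with its vertex set, and $|v|$ denotes the number of edges in the unique path from $o$ to $v$. A self map of $T$ is an arbitrary function $\phi:T\to T$ on vertices. For $f:T\to\mathbb{C}$ put $M_p(0,f)=|f(o)|$ and, for $n\in\mathbb{N}$, $M_p(n,f)=\left(\frac{1}{2}\sum_{|v|=n}|f(v)|^p\right)^{1/p}$ (there are exactly $2$ vertices with $|v|=n$). Let $\|f\|_p=\sup_{n\in\mathbb{N}_0}M_p(n,f)$ and $\mathbb{T}_p=\{f:T\to\mathbb{C} : \|f\|_p<\infty\}$. The composition operator is $C_\phi f=f\circ\phi$. Its operator norm is $\|C_\phi\|=\sup\{\|f\circ\phi\|_p : \|f\|_p=1\}$, and $C_\phi$ is bounded on $\mathbb{T}_p$ if it maps $\mathbb{T}_p$ into itself and $\|C_\phi\|<\infty$. *)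

theory Defs
  imports Complex_Main "HOL-Library.Extended_Nonnegative_Real"
begin

text \<open>
  A simple graph is given by its adjacency relation; its vertex set is the whole type \<open>'a\<close>.
\<close>

definition simple_graph :: "('a \<Rightarrow> 'a \<Rightarrow> bool) \<Rightarrow> bool" where
  "simple_graph E \<longleftrightarrow> symp E \<and> irreflp E"

text \<open>A path is the list of the vertices it visits, so it has one edge less than it has entries.\<close>

definition path_between :: "('a \<Rightarrow> 'a \<Rightarrow> bool) \<Rightarrow> 'a \<Rightarrow> 'a list \<Rightarrow> 'a \<Rightarrow> bool" where
  "path_between E u xs v \<longleftrightarrow>
     xs \<noteq> [] \<and> hd xs = u \<and> last xs = v \<and> successively E xs \<and> distinct xs"

definition graph_connected :: "('a \<Rightarrow> 'a \<Rightarrow> bool) \<Rightarrow> bool" where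
  "graph_connected E \<longleftrightarrow> (\<forall>u v. \<exists>xs. path_between E u xs v)"

text \<open>The closing edge of a cycle leads from the last vertex of the list back to the first.\<close>

definition graph_cycle :: "('a \<Rightarrow> 'a \<Rightarrow> bool) \<Rightarrow> 'a list \<Rightarrow> bool" where
  "graph_cycle E xs \<longleftrightarrow>
     3 \<le> length xs \<and> distinct xs \<and> successively E xs \<and> E (last xs) (hd xs)"

definition homogeneous_tree :: "nat \<Rightarrow> ('a \<Rightarrow> 'a \<Rightarrow> bool) \<Rightarrow> bool" where
  "homogeneous_tree k E \<longleftrightarrow>
     infinite (UNIV :: 'a set) \<and> simple_graph E \<and> graph_connected E \<and>
     (\<nexists>xs. graph_cycle E xs) \<and> (\<forall>v. finite {w. E v w} \<and> card {w. E v w} = k)"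

definition depth :: "('a \<Rightarrow> 'a \<Rightarrow> bool) \<Rightarrow> 'a \<Rightarrow> 'a \<Rightarrow> nat" where
  "depth E r v = length (THE xs. path_between E r xs v) - 1"

text \<open>
  The means carry the normalising constant \<open>1/2\<close> belonging to a 2-homogeneous tree, in which
  every sphere of positive radius around the root \<open>r\<close> has exactly two vertices.
\<close>

definition tree_mean ::
  "('a \<Rightarrow> 'a \<Rightarrow> bool) \<Rightarrow> 'a \<Rightarrow> real \<Rightarrow> nat \<Rightarrow> ('a \<Rightarrow> complex) \<Rightarrow> real" where
  "tree_mean E r p n f =
     (if n = 0 then cmod (f r)
      else (1/2 * (\<Sum>v | depth E r v = n. cmod (f v) powr p)) powr (1/p))"

text \<open>
  Norms take values in \<^typ>\<open>ennreal\<close>, so that the suprema exist unconditionally and finiteness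
  is a genuine condition.
\<close>

definition Tp_norm ::
  "('a \<Rightarrow> 'a \<Rightarrow> bool) \<Rightarrow> 'a \<Rightarrow> real \<Rightarrow> ('a \<Rightarrow> complex) \<Rightarrow> ennreal" where
  "Tp_norm E r p f = (SUP n. ennreal (tree_mean E r p n f))"

definition Tp_space ::
  "('a \<Rightarrow> 'a \<Rightarrow> bool) \<Rightarrow> 'a \<Rightarrow> real \<Rightarrow> ('a \<Rightarrow> complex) set" where
  "Tp_space E r p = {f. Tp_norm E r p f < \<infinity>}"

definition composition_operator :: "('a \<Rightarrow> 'a) \<Rightarrow> ('a \<Rightarrow> complex) \<Rightarrow> 'a \<Rightarrow> complex" where
  "composition_operator \<phi> f = f \<circ> \<phi>"

definition Tp_op_norm ::
  "('a \<Rightarrow> 'a \<Rightarrow> bool) \<Rightarrow> 'a \<Rightarrow> real \<Rightarrow> (('a \<Rightarrow> complex) \<Rightarrow> 'a \<Rightarrow> complex) \<Rightarrow> ennreal" where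
  "Tp_op_norm E r p A = (SUP f \<in> {f. Tp_norm E r p f = 1}. Tp_norm E r p (A f))"

definition Tp_bounded ::
  "('a \<Rightarrow> 'a \<Rightarrow> bool) \<Rightarrow> 'a \<Rightarrow> real \<Rightarrow> (('a \<Rightarrow> complex) \<Rightarrow> 'a \<Rightarrow> complex) \<Rightarrow> bool" where
  "Tp_bounded E r p A \<longleftrightarrow>
     A ` Tp_space E r p \<subseteq> Tp_space E r p \<and> Tp_op_norm E r p A < \<infinity>"

end

theory Submission
  imports Defs
begin

text \<open>
  Paths in an acyclic graph are unique, and in a 2-regular graph a path is determined by its
  first two vertices and its length. Hence a sphere of positive radius has at most two vertices,
  so each single value satisfies \<open>\<bar>f v\<bar>\<^sup>p \<le> 2 \<parallel>f\<parallel>\<^sup>p\<close>. Whatever \<open>\<phi>\<close> is, every mean of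
  \<open>f \<circ> \<phi>\<close> is half of a sum of at most two such values.
\<close>

text \<open>Induction strips the common initial part. Two paths that leave \<open>u\<close> along
  different edges but share the endpoint \<open>v\<close> must meet again, and the first meeting
  closes a cycle.\<close>

lemma acyclic_path_unique:
  assumes sym: "symp E" and acyclic: "\<nexists>zs. graph_cycle E zs"
  shows "path_between E u xs v \<Longrightarrow> path_between E u ys v \<Longrightarrow> xs = ys"
proof (induction xs arbitrary: u ys)
  case Nil
  then show ?case by (simp add: path_between_def)
next
  case (Cons a xs)
  from Cons.prems(1) have a: "a = u" by (simp add: path_between_def)
  obtain ys' where ys: "ys = u # ys'"
    using Cons.prems(2) by (cases ys) (auto simp: path_between_def)
  show ?case
  proof (cases "xs = [] \<or> ys' = []")
    case True
    then show ?thesis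
      using Cons.prems unfolding a ys path_between_def
      by (auto split: if_splits)
  next
    case False
    then have ne: "xs \<noteq> []" "ys' \<noteq> []" by auto
    have px: "successively E xs" "E u (hd xs)" "distinct xs" "u \<notin> set xs" "last xs = v"
      using Cons.prems(1) ne unfolding a path_between_def by (auto simp: successively_Cons)
    have py: "successively E ys'" "E u (hd ys')" "distinct ys'" "u \<notin> set ys'" "last ys' = v"
      using Cons.prems(2) ne unfolding ys path_between_def by (auto simp: successively_Cons)
    show ?thesis
    proof (cases "hd xs = hd ys'")
      case True
      have "path_between E (hd xs) xs v" "path_between E (hd xs) ys' v"
        using px py ne True by (auto simp: path_between_def)
      then show ?thesis using Cons.IH a ys by blast
    next
      case False
      have "\<exists>w\<in>set xs. w \<in> set ys'"
        using ne px(5) py(5) by (metis last_in_set)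
      \<comment> \<open>Taking \<open>w\<close> as the first vertex of \<open>xs\<close> on
        \<open>ys'\<close> keeps \<open>xs1\<close> disjoint from \<open>ys'\<close>, so the cycle
        built below has distinct vertices.\<close>
      then obtain xs1 w xs2 where xs: "xs = xs1 @ w # xs2" and w: "w \<in> set ys'"
        and first: "\<forall>z\<in>set xs1. z \<notin> set ys'"
        using split_list_first_prop[of xs "\<lambda>w. w \<in> set ys'"] by blast
      obtain ys1 ys2 where ys': "ys' = ys1 @ w # ys2"
        using w by (meson split_list)
      \<comment> \<open>Out along \<open>xs\<close> to \<open>w\<close>, then back along
        \<open>ys'\<close> towards \<open>u\<close>. If \<open>xs1\<close> and \<open>ys1\<close>
        were both empty, both tails would start at \<open>w\<close>, so at least three vertices
        occur.\<close>
      let ?c = "u # xs1 @ w # rev ys1"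
      have "length xs1 + length ys1 > 0" using False xs ys' by auto
      then have len: "3 \<le> length ?c" by (cases xs1; cases ys1) simp_all
      have "distinct ?c" using px py first xs ys' by auto
      moreover have "successively E ?c"
      proof -
        have "successively E (u # xs1 @ [w])"
          using px xs by (cases xs1) (auto simp: successively_Cons successively_append_iff hd_append)
        moreover have "successively E (rev (ys1 @ [w]))"
          unfolding successively_rev
          using py(1) ys' sym
          by (auto simp: successively_append_iff conversep_iff
              elim!: successively_mono dest: sympD)
        ultimately show ?thesis
          by (auto simp: successively_append_iff successively_Cons hd_append)
      qed
      moreover have "E (last ?c) (hd ?c)"
        using py(2) ys' sym by (cases ys1) (auto dest: sympD)
      ultimately have "graph_cycle E ?c" using len by (simp add: graph_cycle_def)
      then show ?thesis using acyclic by blast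
    qed
  qed
qed

lemma homogeneous_tree_path_between_the:
  assumes "homogeneous_tree k E"
  shows "path_between E u (THE xs. path_between E u xs v) v"
proof -
  have "\<exists>!xs. path_between E u xs v"
    using assms acyclic_path_unique[of E]
    unfolding homogeneous_tree_def simple_graph_def graph_connected_def by blast
  then show ?thesis by (rule theI')
qed

text \<open>One of the two neighbours of the current vertex is the one just left, and a path cannot
  revisit it; the next vertex is therefore forced.\<close>

lemma two_regular_path_determined:
  assumes reg: "\<And>v. card {w. E v w} = 2" and sym: "symp E"
  shows "successively E (a # b # xs) \<Longrightarrow> successively E (a # b # ys) \<Longrightarrow>
    distinct (a # b # xs) \<Longrightarrow> distinct (a # b # ys) \<Longrightarrow> length xs = length ys \<Longrightarrow> xs = ys"
proof (induction xs arbitrary: a b ys)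
  case Nil
  then show ?case by simp
next
  case (Cons c xs)
  then obtain d ys' where ys: "ys = d # ys'" by (cases ys) auto
  have mem: "a \<in> {w. E b w}" "c \<in> {w. E b w}" "d \<in> {w. E b w}" and neq: "c \<noteq> a" "d \<noteq> a"
    using Cons.prems ys sym by (auto dest: sympD)
  have "c = d"
  proof -
    obtain x y where "{w. E b w} = {x, y}" using reg[of b] unfolding card_2_iff by blast
    then show ?thesis using mem neq by auto
  qed
  then show ?case using Cons.IH[of b c ys'] Cons.prems ys by auto
qed

text \<open>The second vertex of the path from \<open>r\<close> identifies a vertex of the sphere
  and is one of the two neighbours of \<open>r\<close>. Finiteness is stated as well because
  \<open>card\<close> of an infinite set is 0.\<close>

lemma homogeneous_tree_2_sphere:
  assumes T: "homogeneous_tree 2 E" and n: "n \<noteq> 0"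
  shows "finite {v. depth E r v = n}" and "card {v. depth E r v = n} \<le> 2"
proof -
  have sym: "symp E"
    and reg: "\<And>v. card {w. E v w} = 2" and fin: "finite {w. E r w}"
    using T by (auto simp: homogeneous_tree_def simple_graph_def)
  define P where "P v = (THE xs. path_between E r xs v)" for v
  have P: "path_between E r (P v) v" for v
    unfolding P_def by (rule homogeneous_tree_path_between_the[OF T])
  let ?S = "{v. depth E r v = n}"
  have shape: "\<exists>b xs. P v = r # b # xs \<and> length xs = n - 1" if "v \<in> ?S" for v
  proof -
    have "length (P v) = Suc n" "hd (P v) = r"
      using that n P[of v] by (auto simp: depth_def P_def path_between_def)
    then show ?thesis using n
      by (cases "P v"; cases "tl (P v)") auto
  qed
  have inj: "inj_on (\<lambda>v. P v ! 1) ?S"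
  proof (rule inj_onI)
    fix v v' assume "v \<in> ?S" "v' \<in> ?S" and eq: "P v ! 1 = P v' ! 1"
    then obtain b xs b' xs' where s: "P v = r # b # xs" "P v' = r # b' # xs'"
      "length xs = length xs'"
      by (metis shape)
    have "b' = b" using eq s by simp
    then have "xs = xs'"
      using two_regular_path_determined[OF reg sym, of r b xs xs'] P[of v] P[of v'] s
      by (simp add: path_between_def)
    then have "P v = P v'" using s \<open>b' = b\<close> by simp
    then show "v = v'" using P[of v] P[of v'] by (simp add: path_between_def)
  qed
  have sub: "(\<lambda>v. P v ! 1) ` ?S \<subseteq> {w. E r w}"
  proof (rule image_subsetI)
    fix v assume "v \<in> ?S"
    then obtain b xs where "P v = r # b # xs" using shape by blast
    then show "P v ! 1 \<in> {w. E r w}"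
      using P[of v] by (simp add: path_between_def)
  qed
  show "finite ?S" using inj_on_finite[OF inj sub fin] .
  show "card ?S \<le> 2" using card_inj_on_le[OF inj sub fin] reg by simp
qed

lemma tree_mean_nonneg: "0 \<le> tree_mean E r p n f"
  by (simp add: tree_mean_def)

text \<open>Away from the root, the value is one nonnegative term of the sum over its sphere, and
  the factor 2 undoes the normalisation \<open>1/2\<close>.\<close>

lemma norm_powr_le_of_tree_mean_le:
  assumes T: "homogeneous_tree 2 E" and p: "1 \<le> p"
    and M: "\<And>n. tree_mean E r p n f \<le> M"
  shows "cmod (f v) powr p \<le> 2 * M powr p"
proof (cases "depth E r v = 0")
  case True
  \<comment> \<open>Paths are nonempty lists, so depth 0 means a one-entry list, whose head
    \<open>r\<close> is also its last entry \<open>v\<close>.\<close>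
  have "v = r"
    using True homogeneous_tree_path_between_the[OF T, of r v]
    unfolding depth_def by (cases "THE xs. path_between E r xs v") (auto simp: path_between_def)
  then have "cmod (f v) powr p \<le> M powr p"
    using M[of 0] p by (simp add: tree_mean_def powr_mono2)
  then show ?thesis using powr_ge_zero[of M p] by linarith
next
  case False
  define n where "n = depth E r v"
  define S where "S = (\<Sum>v | depth E r v = n. cmod (f v) powr p)"
  have "0 \<le> S" unfolding S_def by (intro sum_nonneg) simp
  have "cmod (f v) powr p \<le> S" unfolding S_def
    using homogeneous_tree_2_sphere(1)[OF T, of n r] False
    by (intro member_le_sum) (auto simp: n_def)
  moreover have "(1/2 * S) powr (1/p) \<le> M"
    using M[of n] False by (simp add: tree_mean_def S_def n_def)
  then have "((1/2 * S) powr (1/p)) powr p \<le> M powr p"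
    using p by (intro powr_mono2) auto
  then have "1/2 * S \<le> M powr p" using p \<open>0 \<le> S\<close> by (simp add: powr_powr)
  ultimately show ?thesis by simp
qed

text \<open>The normalisation \<open>1/2\<close> absorbs the at most two terms on a sphere, so a
  uniform bound on the values passes to the means without loss.\<close>

lemma tree_mean_le_of_norm_powr_le:
  assumes T: "homogeneous_tree 2 E" and p: "1 \<le> p"
    and B: "\<And>v. cmod (g v) powr p \<le> B"
  shows "tree_mean E r p n g \<le> B powr (1/p)"
proof (cases "n = 0")
  case True
  have "(cmod (g r) powr p) powr (1/p) \<le> B powr (1/p)"
    using B p by (intro powr_mono2) auto
  then show ?thesis using True p by (simp add: tree_mean_def powr_powr)
next
  case False
  have "0 \<le> B" using B[of r] powr_ge_zero order_trans by blast
  have "(\<Sum>v | depth E r v = n. cmod (g v) powr p) \<le> real (card {v. depth E r v = n}) * B"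
    using B by (intro sum_bounded_above) auto
  also have "\<dots> \<le> 2 * B"
    using homogeneous_tree_2_sphere(2)[OF T False, of r] \<open>0 \<le> B\<close> by (intro mult_right_mono) auto
  finally have "(1/2 * (\<Sum>v | depth E r v = n. cmod (g v) powr p)) powr (1/p) \<le> B powr (1/p)"
    using p by (intro powr_mono2) (auto intro!: sum_nonneg)
  then show ?thesis using False by (simp add: tree_mean_def)
qed

text \<open>The pointwise bound on \<open>f\<close> is the same at every vertex, so it holds at
  \<open>\<phi> v\<close> for arbitrary \<open>\<phi>\<close>.\<close>

lemma Tp_norm_composition_le:
  assumes T: "homogeneous_tree 2 E" and p: "1 \<le> p"
    and fin: "Tp_norm E r p f < \<infinity>"
  shows "Tp_norm E r p (composition_operator \<phi> f)
    \<le> ennreal ((2 * enn2real (Tp_norm E r p f) powr p) powr (1/p))"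
proof -
  let ?M = "enn2real (Tp_norm E r p f)"
  have M: "tree_mean E r p n f \<le> ?M" for n
  proof -
    have "ennreal (tree_mean E r p n f) \<le> Tp_norm E r p f"
      unfolding Tp_norm_def by (rule SUP_upper) simp
    then show ?thesis
      \<comment> \<open>Since \<open>enn2real\<close> sends infinity to 0, it is monotone only below
        a finite bound; \<open>fin\<close> supplies this.\<close>
      using fin enn2real_mono[of "ennreal (tree_mean E r p n f)"] by (simp add: tree_mean_nonneg)
  qed
  have "tree_mean E r p n (composition_operator \<phi> f) \<le> (2 * ?M powr p) powr (1/p)" for n
    using norm_powr_le_of_tree_mean_le[OF T p M]
    by (intro tree_mean_le_of_norm_powr_le[OF T p]) (simp add: composition_operator_def)
  then show ?thesis
    unfolding Tp_norm_def[of _ _ _ "composition_operator \<phi> f"]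
    by (intro SUP_least ennreal_leI)
qed

theorem theorem2:
  fixes E :: "'a \<Rightarrow> 'a \<Rightarrow> bool" and r :: 'a and p :: real and \<phi> :: "'a \<Rightarrow> 'a"
  assumes "homogeneous_tree 2 E"
    and "1 \<le> p"
  shows "Tp_bounded E r p (composition_operator \<phi>) \<and>
         enn2real (Tp_op_norm E r p (composition_operator \<phi>)) powr p \<le> 2"
proof -
  let ?N = "Tp_op_norm E r p (composition_operator \<phi>)"
  note bound = Tp_norm_composition_le[OF assms]
  \<comment> \<open>Estimating in \<open>ennreal\<close> first yields both finiteness and, through
    \<open>enn2real\<close>, the real inequality. The constant is the previous bound at norm
    1.\<close>
  have N: "?N \<le> ennreal (2 powr (1/p))"
    unfolding Tp_op_norm_def
  proof (rule SUP_least)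
    fix f assume "f \<in> {f. Tp_norm E r p f = 1}"
    then show "Tp_norm E r p (composition_operator \<phi> f) \<le> ennreal (2 powr (1/p))"
      using bound[of r f \<phi>] by simp
  qed
  then have "?N < \<infinity>" using ennreal_less_top le_less_trans infinity_ennreal_def by metis
  moreover have "composition_operator \<phi> ` Tp_space E r p \<subseteq> Tp_space E r p"
  proof (rule image_subsetI)
    fix f assume "f \<in> Tp_space E r p"
    then show "composition_operator \<phi> f \<in> Tp_space E r p"
      using bound[of r f \<phi>] ennreal_less_top le_less_trans
      unfolding Tp_space_def infinity_ennreal_def by blast
  qed
  moreover have "enn2real ?N \<le> 2 powr (1/p)"
    using N by (intro enn2real_leI) auto
  then have "enn2real ?N powr p \<le> (2 powr (1/p)) powr p"
    using assms(2) by (intro powr_mono2) auto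
  ultimately show ?thesis
    using assms(2) by (simp add: Tp_bounded_def powr_powr)
qed

end
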